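(* Let $-1<q<1$, $n\ge1$, and let $a_1,\ldots,a_n$ be real with $|a_k|<1$. Write $\mathbf a^{(k)}=(a_1,\ldots,a_k)$. Define $H_s^{(n)}(\mathbf a^{(n)},q)$, $s\ge0$, by $$\sum_{m\ge0}\frac{a_n^m}{(q)_m}T_{s+m}^{(n-1)}(\mathbf a^{(n-1)},q)=H_s^{(n)}(\mathbf a^{(n)},q)\sum_{m\ge0}\frac{a_n^m}{(q)_m}T_m^{(n-1)}(\mathbf a^{(n-1)},q).$$ Then: (i) $\displaystyle A_n(\mathbf a^{(n)},q)=A_{n-1}(\mathbf a^{(n-1)},q)\sum_{m\ge0}\frac{a_n^m}{(q)_m}T_m^{(n-1)}(\mathbf a^{(n-1)},q)$; (ii) for every $j\ge0$, $\displaystyle T_j^{(n)}(\mathbf a^{(n)},q)=\sum_{s=0}^{j}\binom{j}{s}_q H_s^{(n)}(\mathbf a^{(n)},q)\,a_n^{\,j-s}$.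
   Context: Notation ($0^0=1$): $(q)_n=\prod_{j=1}^n(1-q^j)$, $(q)_\infty=\prod_{j\ge1}(1-q^j)$, $\binom{n}{k}_q=\frac{(q)_n}{(q)_{n-k}(q)_k}$ for $0\le k\le n$. The continuous $q$-Hermite polynomials $h_n(x|q)$ are given by $h_{-1}=0$, $h_0=1$, $h_{n+1}(x|q)=2x\,h_n(x|q)-(1-q^n)h_{n-1}(x|q)$. Their orthogonalizing density on $[-1,1]$ is $$f_h(x|q)=\frac{2(q)_\infty\sqrt{1-x^2}}{\pi}\prod_{k=1}^\infty l(x|q^k),\qquad l(x|a)=(1+a)^2-4ax^2,$$ and their generating function is, for $|t|<1$, $$\varphi_h(x|t,q)=\sum_{j\ge0}\frac{t^j}{(q)_j}h_j(x|q)=\frac{1}{\prod_{k=0}^\infty (1-2tq^kx+t^2q^{2k})}.$$ For $n\ge0$, $g_n(x|\mathbf a^{(n)},q)=f_h(x|q)\prod_{j=1}^n\varphi_h(x|a_j,q)$ (empty product $=1$). The quantities $A_n$ and $T_j^{(n)}$ are the normalizing constant and the Fourier coefficients in the expansion $$g_n(x|\mathbf a^{(n)},q)=A_n(\mathbf a^{(n)},q)f_h(x|q)\sum_{j\ge0}\frac{T_j^{(n)}(\mathbf a^{(n)},q)}{(q)_j}h_j(x|q),$$ that is, $$A_n(\mathbf a^{(n)},q)=\int_{-1}^1 g_n(x|\mathbf a^{(n)},q)\,dx,\qquad A_n(\mathbf a^{(n)},q)\,T_j^{(n)}(\mathbf a^{(n)},q)=\int_{-1}^1 h_j(x|q)\,g_n(x|\mathbf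 a^{(n)},q)\,dx .$$ *)

theory Defs
  imports "HOL-Analysis.Analysis"
begin

definition qpoch :: "real \<Rightarrow> nat \<Rightarrow> real" where
  "qpoch q n = (\<Prod>j=1..n. 1 - q ^ j)"

definition qpoch_inf :: "real \<Rightarrow> real" where
  "qpoch_inf q = (\<Prod>j. 1 - q ^ Suc j)"

text \<open>Only meaningful for \<open>k \<le> n\<close>.\<close>

definition qbinom :: "real \<Rightarrow> nat \<Rightarrow> nat \<Rightarrow> real" where
  "qbinom q n k = qpoch q n / (qpoch q (n - k) * qpoch q k)"

text \<open>
  The three-term recurrence is started at \<open>h\<^sub>1(x|q) = 2x\<close>, which is what it gives
  for \<open>n = 0\<close> with \<open>h\<^sub>-\<^sub>1 = 0\<close>.
\<close>

fun qherm :: "real \<Rightarrow> nat \<Rightarrow> real \<Rightarrow> real" where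
  "qherm q 0 x = 1"
| "qherm q (Suc 0) x = 2 * x"
| "qherm q (Suc (Suc n)) x =
     2 * x * qherm q (Suc n) x - (1 - q ^ Suc n) * qherm q n x"

definition l_fun :: "real \<Rightarrow> real \<Rightarrow> real" where
  "l_fun x a = (1 + a)\<^sup>2 - 4 * a * x\<^sup>2"

definition f_h :: "real \<Rightarrow> real \<Rightarrow> real" where
  "f_h q x = 2 * qpoch_inf q * sqrt (1 - x\<^sup>2) / pi * (\<Prod>k. l_fun x (q ^ Suc k))"

text \<open>The generating function of the polynomials; the series converges for \<open>\<bar>t\<bar> < 1\<close> and \<open>\<bar>x\<bar> \<le> 1\<close>.\<close>

definition phi_h :: "real \<Rightarrow> real \<Rightarrow> real \<Rightarrow> real" where
  "phi_h q t x = (\<Sum>j. t ^ j / qpoch q j * qherm q j x)"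

text \<open>
  The parameter vector \<open>(a\<^sub>1, \<dots>, a\<^sub>n)\<close> is the initial segment of a sequence \<open>a\<close>,
  indexed from 1; the values of \<open>a\<close> at \<open>0\<close> and beyond \<open>n\<close> are irrelevant.
\<close>

definition g_fun :: "real \<Rightarrow> nat \<Rightarrow> (nat \<Rightarrow> real) \<Rightarrow> real \<Rightarrow> real" where
  "g_fun q n a x = f_h q x * (\<Prod>j=1..n. phi_h q (a j) x)"

definition A_coeff :: "real \<Rightarrow> nat \<Rightarrow> (nat \<Rightarrow> real) \<Rightarrow> real" where
  "A_coeff q n a = integral {-1..1} (g_fun q n a)"

text \<open>
  The division is harmless: \<open>g_fun\<close> is positive on the open interval, so \<open>A_coeff\<close> is
  positive when \<open>-1 < q < 1\<close> and all parameters have modulus below 1.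
\<close>

definition T_coeff :: "real \<Rightarrow> nat \<Rightarrow> (nat \<Rightarrow> real) \<Rightarrow> nat \<Rightarrow> real" where
  "T_coeff q n a j =
     integral {-1..1} (\<lambda>x. qherm q j x * g_fun q n a x) / A_coeff q n a"

end

theory Submission
  imports Defs
begin

text \<open>
  The theorem is an identity between functions of \<open>x\<close>, integrated against
  \<open>g\<^sub>n\<^sub>-\<^sub>1\<close>. Put \<open>F\<^sub>s(t, x) = \<Sum>\<^sub>m t\<^sup>m h\<^sub>s\<^sub>+\<^sub>m(x) / (q)\<^sub>m\<close>, so that \<open>F\<^sub>0\<close> is the
  generating function \<open>\<phi>\<^sub>h\<close>. Integrating termwise, the \<open>s\<close>-shifted series of the theorem
  is \<open>\<integral> F\<^sub>s(a\<^sub>n, x) g\<^sub>n\<^sub>-\<^sub>1(x) dx / A\<^sub>n\<^sub>-\<^sub>1\<close>. For \<open>s = 0\<close> this is \<open>A\<^sub>n / A\<^sub>n\<^sub>-\<^sub>1\<close>, because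
  \<open>g\<^sub>n = g\<^sub>n\<^sub>-\<^sub>1 F\<^sub>0(a\<^sub>n, \<cdot>)\<close>, and this is part (i). Part (ii) is the integrated form of
  \<open>h\<^sub>j(x) F\<^sub>0(t, x) = \<Sum>\<^sub>s\<^sub>\<le>\<^sub>j [j, s]\<^sub>q t\<^sup>j\<^sup>-\<^sup>s F\<^sub>s(t, x)\<close>, where \<open>[j, s]\<^sub>q\<close> is the \<open>q\<close>-binomial
  coefficient.

  To see this identity, note that the recurrence of the \<open>h\<^sub>n\<close>, together with the splitting
  \<open>1 - q\<^sup>s\<^sup>+\<^sup>m = (1 - q\<^sup>s) + q\<^sup>s (1 - q\<^sup>m)\<close>, gives
  \<open>F\<^sub>s\<^sub>+\<^sub>1 = (2x - t q\<^sup>s) F\<^sub>s - (1 - q\<^sup>s) F\<^sub>s\<^sub>-\<^sub>1\<close> (\<open>qherm_gf_Suc\<close>). By the \<open>q\<close>-Pascal rule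
  the right-hand side, as a sequence in \<open>j\<close>, then satisfies the recurrence of the \<open>h\<^sub>j\<close>
  (\<open>qherm_mult_phi_h\<close>).

  Two analytic facts are needed. Termwise integration follows from uniform convergence on
  \<open>[-1, 1]\<close>, which holds because \<open>h\<^sub>n\<close> grows there more slowly than any geometric sequence of
  ratio above 1 (\<open>qherm_growth\<close>). The divisions by \<open>A\<^sub>n\<close> and \<open>A\<^sub>n\<^sub>-\<^sub>1\<close> are legitimate because
  all \<open>g\<^sub>n\<close> are continuous on \<open>[-1, 1]\<close> and positive inside. For \<open>\<phi>\<^sub>h\<close>, positivity comes from
  the functional equation \<open>(1 - 2tx + t\<^sup>2) \<phi>\<^sub>h(t) = \<phi>\<^sub>h(qt)\<close>: iterating it moves the argument
  towards 0, where \<open>\<phi>\<^sub>h\<close> is near 1, and every factor taken out on the way is positive.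
\<close>

section \<open>The q-factorial and the q-binomial coefficient\<close>

lemma qpoch_0 [simp]: "qpoch q 0 = 1"
  by (simp add: qpoch_def)

lemma qpoch_Suc: "qpoch q (Suc n) = (1 - q ^ Suc n) * qpoch q n"
  by (simp add: qpoch_def mult.commute)

lemma abs_power_Suc_less_1:
  fixes q :: real
  assumes "\<bar>q\<bar> < 1"
  shows "\<bar>q ^ Suc n\<bar> < 1"
  using power_decreasing[of 1 "Suc n" "\<bar>q\<bar>"] assms unfolding power_abs by simp

lemma one_minus_power_pos:
  fixes q :: real
  assumes "\<bar>q\<bar> < 1"
  shows "0 < 1 - q ^ Suc n"
  using abs_power_Suc_less_1[OF assms, of n] by linarith

lemma qpoch_pos:
  assumes "\<bar>q\<bar> < 1"
  shows "qpoch q n > 0"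
proof (induction n)
  case (Suc n)
  then show ?case
    unfolding qpoch_Suc by (intro mult_pos_pos one_minus_power_pos[OF assms])
qed simp

lemma qpoch_eq_prod_lessThan: "qpoch q n = (\<Prod>k<n. 1 - q ^ Suc k)"
  by (induction n) (simp_all add: qpoch_Suc del: power_Suc)

lemma convergent_prod_qpoch:
  assumes "\<bar>q\<bar> < 1"
  shows "convergent_prod (\<lambda>k. 1 - q ^ Suc k :: real)"
proof -
  have "summable (\<lambda>k. norm ((1 - q ^ Suc k) - 1))"
    using assms by (simp add: power_abs abs_mult summable_mult summable_geometric)
  then show ?thesis
    by (intro abs_convergent_prod_imp_convergent_prod summable_imp_abs_convergent_prod)
qed

lemma qpoch_inf_pos:
  assumes "\<bar>q\<bar> < 1"
  shows "qpoch_inf q > 0"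
  unfolding qpoch_inf_def
  by (intro less_0_prodinf convergent_prod_qpoch one_minus_power_pos assms)

lemma qpoch_tendsto:
  assumes "\<bar>q\<bar> < 1"
  shows "qpoch q \<longlonglongrightarrow> qpoch_inf q"
proof -
  have "(\<lambda>n. \<Prod>k\<le>n. 1 - q ^ Suc k) \<longlonglongrightarrow> qpoch_inf q"
    unfolding qpoch_inf_def by (intro convergent_prod_LIMSEQ convergent_prod_qpoch assms)
  then have "(\<lambda>n. qpoch q (Suc n)) \<longlonglongrightarrow> qpoch_inf q"
    by (simp only: qpoch_eq_prod_lessThan lessThan_Suc_atMost)
  then show ?thesis
    by (simp only: filterlim_sequentially_Suc)
qed

text \<open>
  The limit of \<open>(q)\<^sub>n\<close> is not 0, so the coefficients \<open>1 / (q)\<^sub>n\<close> do not shrink radii of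
  convergence.
\<close>

lemma inverse_qpoch_bounded:
  assumes "\<bar>q\<bar> < 1"
  obtains C where "C > 0" "\<And>n. 1 / qpoch q n \<le> C"
proof -
  have "(\<lambda>n. 1 / qpoch q n) \<longlonglongrightarrow> 1 / qpoch_inf q"
    using qpoch_inf_pos[OF assms] by (intro tendsto_intros qpoch_tendsto[OF assms]) auto
  then have "Bseq (\<lambda>n. 1 / qpoch q n)"
    using convergentI convergent_imp_Bseq by blast
  then obtain C where "C > 0" "\<And>n. norm (1 / qpoch q n) \<le> C"
    unfolding Bseq_def by blast
  then show thesis
    by (intro that[of C]) (auto intro: order_trans[OF abs_ge_self])
qed

lemma qbinom_n_0:
  assumes "\<bar>q\<bar> < 1"
  shows "qbinom q n 0 = 1"
  using qpoch_pos[OF assms, of n] by (simp add: qbinom_def)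

lemma qbinom_n_n:
  assumes "\<bar>q\<bar> < 1"
  shows "qbinom q n n = 1"
  using qpoch_pos[OF assms, of n] by (simp add: qbinom_def)

lemma qbinom_pascal:
  assumes "\<bar>q\<bar> < 1" "s < j"
  shows "qbinom q (Suc j) (Suc s) = qbinom q j s + q ^ Suc s * qbinom q j (Suc s)"
proof -
  obtain d where j: "j = Suc (s + d)"
    using assms(2) less_imp_Suc_add by blast
  have ne: "qpoch q k \<noteq> 0" "1 - q ^ Suc k \<noteq> 0" for k
    using qpoch_pos[OF assms(1), of k] one_minus_power_pos[OF assms(1), of k] by auto
  have split: "1 - q ^ Suc j = (1 - q ^ Suc s) + q ^ Suc s * (1 - q ^ Suc d)"
    by (simp add: j power_add algebra_simps)
  have "qbinom q (Suc j) (Suc s) =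
      (1 - q ^ Suc j) * qpoch q j /
        ((1 - q ^ Suc d) * qpoch q d * ((1 - q ^ Suc s) * qpoch q s))"
    by (simp add: qbinom_def qpoch_Suc j del: power_Suc)
  also have "\<dots> = qpoch q j / ((1 - q ^ Suc d) * qpoch q d * qpoch q s)
      + q ^ Suc s * (qpoch q j / (qpoch q d * ((1 - q ^ Suc s) * qpoch q s)))"
    unfolding split using ne(1)[of d] ne(1)[of s] ne(2)[of d] ne(2)[of s]
    by (simp add: divide_simps del: power_Suc) (simp add: algebra_simps)
  also have "\<dots> = qbinom q j s + q ^ Suc s * qbinom q j (Suc s)"
    by (simp add: qbinom_def qpoch_Suc j del: power_Suc)
  finally show ?thesis .
qed

lemma qbinom_absorb:
  assumes "\<bar>q\<bar> < 1" "s \<le> j"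
  shows "(1 - q ^ Suc s) * qbinom q (Suc j) (Suc s) = (1 - q ^ Suc j) * qbinom q j s"
  using one_minus_power_pos[OF assms(1), of s]
  by (simp add: qbinom_def qpoch_Suc del: power_Suc)

section \<open>Growth of the polynomials on the interval\<close>

text \<open>Truncated subtraction is harmless here: at \<open>n = 0\<close> the last term vanishes.\<close>

lemma qherm_Suc: "qherm q (Suc n) x = 2 * x * qherm q n x - (1 - q ^ n) * qherm q (n - 1) x"
  by (cases n) simp_all

lemma continuous_on_qherm: "continuous_on X (qherm q n)"
proof (induction n rule: less_induct)
  case (less n)
  show ?case
  proof (cases n)
    case 0
    then show ?thesis by simp
  next
    case (Suc k)
    have eq: "qherm q n = (\<lambda>x. 2 * x * qherm q k x - (1 - q ^ k) * qherm q (k - 1) x)"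
      unfolding Suc by (rule ext) (rule qherm_Suc)
    show ?thesis
      unfolding eq by (intro continuous_intros less.IH) (simp_all add: Suc)
  qed
qed

lemma qherm_crude_bound:
  assumes q: "\<bar>q\<bar> < 1" and x: "\<bar>x\<bar> \<le> 1"
  shows "\<bar>qherm q n x\<bar> \<le> 3 ^ n"
proof (induction n rule: induct_nat_012)
  case 0
  then show ?case by simp
next
  case 1
  then show ?case using x by simp
next
  case (ge2 n)
  have "0 < 1 - q ^ Suc n" "\<bar>q ^ Suc n\<bar> \<le> 1"
    using one_minus_power_pos[OF q, of n] q by (auto simp only: power_abs intro!: power_le_one)
  then have "\<bar>1 - q ^ Suc n\<bar> \<le> 2"
    by linarith
  then have "\<bar>(1 - q ^ Suc n) * qherm q n x\<bar> \<le> 2 * 3 ^ n"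
    unfolding abs_mult using ge2 by (intro mult_mono) auto
  moreover have "\<bar>2 * x * qherm q (Suc n) x\<bar> \<le> 2 * 3 ^ Suc n"
    unfolding abs_mult using ge2 x by (intro mult_mono) auto
  ultimately have "\<bar>qherm q (Suc (Suc n)) x\<bar> \<le> 2 * 3 ^ Suc n + 2 * 3 ^ n"
    unfolding qherm.simps by linarith
  also have "\<dots> \<le> 3 ^ Suc (Suc n)"
    by simp
  finally show ?case .
qed

text \<open>
  For \<open>x \<in> [-1, 1]\<close> write \<open>2x = u + cnj u\<close> with \<open>\<bar>u\<bar> = 1\<close>. Then
  \<open>d\<^sub>n = h\<^sub>n\<^sub>+\<^sub>1 - u h\<^sub>n\<close> satisfies \<open>d\<^sub>n\<^sub>+\<^sub>1 = cnj u d\<^sub>n + q\<^sup>n\<^sup>+\<^sup>1 h\<^sub>n\<close>: up to a rapidly decreasing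
  perturbation the recurrence is an isometry. Once \<open>\<bar>q\<bar>\<^sup>n\<close> is below \<open>(\<rho> - 1)\<^sup>2\<close>, the bounds
  \<open>\<bar>h\<^sub>n\<bar> \<le> K \<rho>\<^sup>n\<close> and \<open>\<bar>d\<^sub>n\<bar> \<le> (\<rho> - 1) K \<rho>\<^sup>n\<close> therefore propagate together.
\<close>

lemma qherm_growth:
  fixes q \<rho> :: real
  assumes q: "\<bar>q\<bar> < 1" and \<rho>: "\<rho> > 1"
  obtains K where "K > 0" "\<And>n x. \<bar>x\<bar> \<le> 1 \<Longrightarrow> \<bar>qherm q n x\<bar> \<le> K * \<rho> ^ n"
proof -
  have "(\<lambda>n. \<bar>q\<bar> ^ n) \<longlonglongrightarrow> 0"
    using q by (intro LIMSEQ_power_zero) auto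
  then have "\<forall>\<^sub>F n in sequentially. \<bar>q\<bar> ^ n < (\<rho> - 1)\<^sup>2"
    using \<rho> by (intro order_tendstoD(2)[where y = 0]) auto
  then obtain N where N: "\<And>n. n \<ge> N \<Longrightarrow> \<bar>q\<bar> ^ n < (\<rho> - 1)\<^sup>2"
    unfolding eventually_sequentially by blast
  \<comment> \<open>The factor 4 serves the start of the propagation: \<open>\<bar>d\<^sub>N\<bar> \<le> 3\<^sup>N\<^sup>+\<^sup>1 + 3\<^sup>N = 4 \<cdot> 3\<^sup>N\<close>.\<close>
  define K where "K = 4 * 3 ^ N * (1 + 1 / (\<rho> - 1))"
  have K_ge: "4 * 3 ^ N \<le> K" "4 * 3 ^ N \<le> (\<rho> - 1) * K"
  proof -
    show "4 * 3 ^ N \<le> K"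
      using \<rho> by (simp add: K_def)
    have "(\<rho> - 1) * K = \<rho> * (4 * 3 ^ N)"
      using \<rho> by (simp add: K_def divide_simps)
    then show "4 * 3 ^ N \<le> (\<rho> - 1) * K"
      using \<rho> by simp
  qed
  have K_pos: "K > 0"
    by (rule less_le_trans[OF _ K_ge(1)]) simp
  have \<rho>_ge: "1 \<le> \<rho> ^ n" for n
    using \<rho> by simp
  have bound: "\<bar>qherm q n x\<bar> \<le> K * \<rho> ^ n" if x: "\<bar>x\<bar> \<le> 1" for n x
  proof (cases "n \<ge> N")
    case False
    have "\<bar>qherm q n x\<bar> \<le> 3 ^ n"
      by (rule qherm_crude_bound[OF q x])
    also have "(3::real) ^ n \<le> 3 ^ N"
      using False by (intro power_increasing) auto
    also have "\<dots> \<le> K"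
      using K_ge(1) by (rule order_trans[rotated]) simp
    also have "\<dots> \<le> K * \<rho> ^ n"
      using K_pos \<rho>_ge[of n] by simp
    finally show ?thesis .
  next
    case True
    define u where "u = Complex x (sqrt (1 - x\<^sup>2))"
    define h where "h = (\<lambda>n. complex_of_real (qherm q n x))"
    have x2: "x\<^sup>2 \<le> 1"
      using x by (simp add: abs_square_le_1)
    have norm_u: "norm u = 1"
      using x2 by (simp add: u_def cmod_def)
    have u_sum: "u + cnj u = of_real (2 * x)"
      by (simp add: u_def complex_eq_iff)
    have u_mult: "u * cnj u = 1"
      using norm_u by (simp add: complex_mult_cnj cmod_def complex_eq_iff)
    have "norm (h n) \<le> K * \<rho> ^ n \<and> norm (h (Suc n) - u * h n) \<le> (\<rho> - 1) * K * \<rho> ^ n"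
      using True
    proof (induction n rule: dec_induct)
      case base
      have hN: "norm (h N) \<le> 3 ^ N" "norm (h (Suc N)) \<le> 3 ^ Suc N"
        unfolding h_def norm_of_real by (rule qherm_crude_bound[OF q x])+
      have "norm (h (Suc N) - u * h N) \<le> norm (h (Suc N)) + norm (h N)"
        using norm_triangle_ineq4[of "h (Suc N)" "u * h N"] by (simp add: norm_mult norm_u)
      also have "\<dots> \<le> 4 * 3 ^ N"
        using hN by simp
      also have "\<dots> \<le> (\<rho> - 1) * K"
        by (rule K_ge)
      also have "\<dots> \<le> (\<rho> - 1) * K * \<rho> ^ N"
        using \<rho> K_pos \<rho>_ge[of N] by simp
      finally have d: "norm (h (Suc N) - u * h N) \<le> (\<rho> - 1) * K * \<rho> ^ N" .
      have "norm (h N) \<le> K"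
        using hN(1) K_ge(1) by (smt (verit) zero_less_power)
      also have "\<dots> \<le> K * \<rho> ^ N"
        using K_pos \<rho>_ge[of N] by simp
      finally show ?case
        using d by blast
    next
      case (step n)
      have hn: "norm (h n) \<le> K * \<rho> ^ n"
        and dn: "norm (h (Suc n) - u * h n) \<le> (\<rho> - 1) * K * \<rho> ^ n"
        using step.IH by auto
      have "norm (h (Suc n)) \<le> norm (h (Suc n) - u * h n) + norm (u * h n)"
        by (metis diff_add_cancel norm_triangle_ineq)
      also have "\<dots> \<le> (\<rho> - 1) * K * \<rho> ^ n + K * \<rho> ^ n"
        using hn dn by (simp add: norm_mult norm_u)
      also have "\<dots> = K * \<rho> ^ Suc n"
        by (simp add: algebra_simps)
      finally have h': "norm (h (Suc n)) \<le> K * \<rho> ^ Suc n" .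
      have "h (Suc (Suc n)) = (u + cnj u) * h (Suc n) - (1 - of_real (q ^ Suc n)) * h n"
        unfolding u_sum h_def qherm.simps by simp
      also have "\<dots> = u * h (Suc n) + cnj u * (h (Suc n) - u * h n)
          + (u * cnj u - 1) * h n + of_real (q ^ Suc n) * h n"
        by (simp add: algebra_simps)
      finally have "h (Suc (Suc n)) - u * h (Suc n) =
          cnj u * (h (Suc n) - u * h n) + of_real (q ^ Suc n) * h n"
        unfolding u_mult by simp
      also have "norm \<dots> \<le> norm (cnj u * (h (Suc n) - u * h n)) + norm (of_real (q ^ Suc n) * h n)"
        by (rule norm_triangle_ineq)
      also have "\<dots> = norm (h (Suc n) - u * h n) + \<bar>q\<bar> ^ Suc n * norm (h n)"
        by (simp add: norm_mult norm_u norm_power)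
      also have "\<dots> \<le> (\<rho> - 1) * K * \<rho> ^ n + (\<rho> - 1)\<^sup>2 * (K * \<rho> ^ n)"
        using N[of "Suc n"] step.hyps hn dn by (intro add_mono mult_mono) auto
      also have "\<dots> = (\<rho> - 1) * K * \<rho> ^ Suc n"
        by (simp add: algebra_simps power2_eq_square)
      finally show ?case
        using h' by blast
    qed
    then show ?thesis
      by (simp add: h_def)
  qed
  show thesis
    by (rule that[OF K_pos bound])
qed

section \<open>The shifted generating functions\<close>

definition qherm_gf :: "real \<Rightarrow> nat \<Rightarrow> real \<Rightarrow> real \<Rightarrow> real" where
  "qherm_gf q s t x = (\<Sum>m. t ^ m / qpoch q m * qherm q (s + m) x)"

lemma phi_h_eq_qherm_gf: "phi_h q t x = qherm_gf q 0 t x"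
  by (simp add: phi_h_def qherm_gf_def)

text \<open>A single summable majorant for all \<open>x \<in> [-1, 1]\<close>; summability and continuity both rest on it.\<close>

lemma qherm_gf_majorant:
  assumes q: "\<bar>q\<bar> < 1" and t: "\<bar>t\<bar> < 1"
  obtains M where "summable M"
    "\<And>m x. \<bar>x\<bar> \<le> 1 \<Longrightarrow> \<bar>t ^ m / qpoch q m * qherm q (s + m) x\<bar> \<le> M m"
proof -
  \<comment> \<open>Any \<open>\<rho> > 1\<close> with \<open>\<bar>t\<bar> \<rho> < 1\<close> would do; this choice also covers \<open>t = 0\<close>.\<close>
  define \<rho> where "\<rho> = 2 / (1 + \<bar>t\<bar>)"
  have \<rho>: "\<rho> > 1" "\<bar>t\<bar> * \<rho> < 1"
    using t by (simp_all add: \<rho>_def field_simps)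
  obtain K where K: "K > 0" "\<And>n x. \<bar>x\<bar> \<le> 1 \<Longrightarrow> \<bar>qherm q n x\<bar> \<le> K * \<rho> ^ n"
    using qherm_growth[OF q \<rho>(1)] by blast
  obtain C where C: "C > 0" "\<And>n. 1 / qpoch q n \<le> C"
    using inverse_qpoch_bounded[OF q] by blast
  show thesis
  proof (rule that[of "\<lambda>m. C * K * \<rho> ^ s * (\<bar>t\<bar> * \<rho>) ^ m"])
    show "summable (\<lambda>m. C * K * \<rho> ^ s * (\<bar>t\<bar> * \<rho>) ^ m)"
      using \<rho> by (intro summable_mult summable_geometric) (simp add: abs_mult)
  next
    fix m and x :: real
    assume x: "\<bar>x\<bar> \<le> 1"
    have "\<bar>t ^ m / qpoch q m * qherm q (s + m) x\<bar>
        = \<bar>t\<bar> ^ m * (1 / qpoch q m * \<bar>qherm q (s + m) x\<bar>)"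
      using qpoch_pos[OF q, of m] by (simp add: abs_mult power_abs)
    also have "\<dots> \<le> \<bar>t\<bar> ^ m * (C * (K * \<rho> ^ (s + m)))"
      using C K(2)[OF x] by (intro mult_left_mono mult_mono) auto
    also have "\<dots> = C * K * \<rho> ^ s * (\<bar>t\<bar> * \<rho>) ^ m"
      by (simp add: power_add power_mult_distrib)
    finally show "\<bar>t ^ m / qpoch q m * qherm q (s + m) x\<bar> \<le> C * K * \<rho> ^ s * (\<bar>t\<bar> * \<rho>) ^ m" .
  qed
qed

lemma summable_qherm_gf:
  assumes q: "\<bar>q\<bar> < 1" and t: "\<bar>t\<bar> < 1" and x: "\<bar>x\<bar> \<le> 1"
  shows "summable (\<lambda>m. t ^ m / qpoch q m * qherm q (s + m) x)"
proof -
  obtain M where M: "summable M"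
    and le: "\<And>m x. \<bar>x\<bar> \<le> 1 \<Longrightarrow> \<bar>t ^ m / qpoch q m * qherm q (s + m) x\<bar> \<le> M m"
    using qherm_gf_majorant[OF q t] by blast
  from M show ?thesis
    by (rule summable_comparison_test'[of M 0]) (unfold real_norm_def, rule le[OF x])
qed

lemma uniform_limit_qherm_gf:
  assumes q: "\<bar>q\<bar> < 1" and t: "\<bar>t\<bar> < 1"
  shows "uniform_limit {-1..1} (\<lambda>N x. \<Sum>m<N. t ^ m / qpoch q m * qherm q (s + m) x)
    (qherm_gf q s t) sequentially"
proof -
  obtain M where M: "summable M"
    and le: "\<And>m x. \<bar>x\<bar> \<le> 1 \<Longrightarrow> \<bar>t ^ m / qpoch q m * qherm q (s + m) x\<bar> \<le> M m"
    using qherm_gf_majorant[OF q t] by blast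
  have "norm (t ^ m / qpoch q m * qherm q (s + m) x) \<le> M m" if "x \<in> {-1..1}" for m x
    unfolding real_norm_def using that by (intro le) auto
  then show ?thesis
    unfolding qherm_gf_def using M by (rule Weierstrass_m_test)
qed

lemma continuous_on_qherm_gf:
  assumes q: "\<bar>q\<bar> < 1" and t: "\<bar>t\<bar> < 1"
  shows "continuous_on {-1..1} (qherm_gf q s t)"
  by (rule uniform_limit_theorem[OF _ uniform_limit_qherm_gf[OF q t]])
    (intro always_eventually allI continuous_on_sum continuous_on_mult_left continuous_on_qherm, simp)

text \<open>
  The denominator \<open>(q)\<^sub>m\<close> makes multiplication of the \<open>m\<close>th term by \<open>1 - q\<^sup>m\<close> a shift of
  the summation index.
\<close>

lemma sums_qherm_gf_index_shift:
  assumes q: "\<bar>q\<bar> < 1" and t: "\<bar>t\<bar> < 1" and x: "\<bar>x\<bar> \<le> 1"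
  shows "(\<lambda>m. (1 - q ^ m) * (t ^ m / qpoch q m * qherm q (s + m - 1) x)) sums (t * qherm_gf q s t x)"
proof -
  define f where "f = (\<lambda>m. (1 - q ^ m) * (t ^ m / qpoch q m * qherm q (s + m - 1) x))"
  have "f (Suc m) = t * (t ^ m / qpoch q m * qherm q (s + m) x)" for m
    using one_minus_power_pos[OF q, of m] qpoch_pos[OF q, of m]
    unfolding f_def qpoch_Suc by (simp del: power_Suc) simp
  moreover have "(\<lambda>m. t * (t ^ m / qpoch q m * qherm q (s + m) x)) sums (t * qherm_gf q s t x)"
    unfolding qherm_gf_def by (intro sums_mult summable_sums summable_qherm_gf assms)
  ultimately have "(\<lambda>m. f (Suc m)) sums (t * qherm_gf q s t x)"
    by simp
  moreover have "f 0 = 0"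
    by (simp add: f_def)
  ultimately have "f sums (t * qherm_gf q s t x)"
    by (simp add: sums_Suc_iff)
  then show ?thesis
    by (simp only: f_def)
qed

lemma qherm_gf_Suc:
  assumes q: "\<bar>q\<bar> < 1" and t: "\<bar>t\<bar> < 1" and x: "\<bar>x\<bar> \<le> 1"
  shows "qherm_gf q (Suc s) t x =
    (2 * x - t * q ^ s) * qherm_gf q s t x - (1 - q ^ s) * qherm_gf q (s - 1) t x"
proof -
  have sums: "(\<lambda>m. t ^ m / qpoch q m * qherm q (s + m) x) sums qherm_gf q s t x" for s
    unfolding qherm_gf_def by (intro summable_sums summable_qherm_gf assms)
  have "(\<lambda>m. 2 * x * (t ^ m / qpoch q m * qherm q (s + m) x)
        - (1 - q ^ s) * (t ^ m / qpoch q m * qherm q (s - 1 + m) x)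
        - q ^ s * ((1 - q ^ m) * (t ^ m / qpoch q m * qherm q (s + m - 1) x)))
      sums (2 * x * qherm_gf q s t x - (1 - q ^ s) * qherm_gf q (s - 1) t x
        - q ^ s * (t * qherm_gf q s t x))"
    by (intro sums_diff sums_mult sums sums_qherm_gf_index_shift assms)
  also have "(\<lambda>m. 2 * x * (t ^ m / qpoch q m * qherm q (s + m) x)
        - (1 - q ^ s) * (t ^ m / qpoch q m * qherm q (s - 1 + m) x)
        - q ^ s * ((1 - q ^ m) * (t ^ m / qpoch q m * qherm q (s + m - 1) x)))
      = (\<lambda>m. t ^ m / qpoch q m * qherm q (Suc s + m) x)"
  proof
    fix m
    \<comment> \<open>At \<open>s = 0\<close> the indices \<open>s - 1 + m\<close> and \<open>s + m - 1\<close> may differ, but then \<open>1 - q\<^sup>s = 0\<close>.\<close>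
    have "(1 - q ^ s) * qherm q (s - 1 + m) x = (1 - q ^ s) * qherm q (s + m - 1) x"
      by (cases s) auto
    then have rec: "qherm q (Suc s + m) x = 2 * x * qherm q (s + m) x
        - (1 - q ^ s) * qherm q (s - 1 + m) x - q ^ s * ((1 - q ^ m) * qherm q (s + m - 1) x)"
      by (simp add: qherm_Suc power_add algebra_simps)
    define c where "c = t ^ m / qpoch q m"
    then show "2 * x * (t ^ m / qpoch q m * qherm q (s + m) x)
        - (1 - q ^ s) * (t ^ m / qpoch q m * qherm q (s - 1 + m) x)
        - q ^ s * ((1 - q ^ m) * (t ^ m / qpoch q m * qherm q (s + m - 1) x))
      = t ^ m / qpoch q m * qherm q (Suc s + m) x"
      unfolding rec c_def[symmetric] by (simp only: algebra_simps)
  qed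
  finally show ?thesis
    using sums[of "Suc s"] by (simp add: sums_iff algebra_simps)
qed

text \<open>
  Both sides agree at \<open>j = 0\<close> and satisfy the recurrence of the \<open>h\<^sub>j\<close>. In \<open>2x S\<^sub>j\<close>, where \<open>S\<^sub>j\<close> is the right-hand
  side, replace \<open>2x F\<^sub>s\<close> by \<open>F\<^sub>s\<^sub>+\<^sub>1 + t q\<^sup>s F\<^sub>s + (1 - q\<^sup>s) F\<^sub>s\<^sub>-\<^sub>1\<close>. The first two terms combine
  by the \<open>q\<close>-Pascal rule to \<open>S\<^sub>j\<^sub>+\<^sub>1\<close>, the last gives \<open>(1 - q\<^sup>j) S\<^sub>j\<^sub>-\<^sub>1\<close> by absorption.
\<close>

lemma qherm_mult_phi_h:
  assumes q: "\<bar>q\<bar> < 1" and t: "\<bar>t\<bar> < 1" and x: "\<bar>x\<bar> \<le> 1"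
  shows "qherm q j x * phi_h q t x = (\<Sum>s=0..j. qbinom q j s * t ^ (j - s) * qherm_gf q s t x)"
proof -
  define F where "F = (\<lambda>s. qherm_gf q s t x)"
  define S where "S = (\<lambda>j. \<Sum>s\<le>j. qbinom q j s * t ^ (j - s) * F s)"
  have F: "2 * x * F s = F (Suc s) + t * q ^ s * F s + (1 - q ^ s) * F (s - 1)" for s
    unfolding F_def qherm_gf_Suc[OF assms] by (simp add: algebra_simps)
  have absorb: "(\<Sum>s\<le>j. qbinom q j s * t ^ (j - s) * ((1 - q ^ s) * F (s - 1)))
      = (1 - q ^ j) * S (j - 1)" for j
  proof (cases j)
    case (Suc i)
    have "qbinom q (Suc i) (Suc s) * t ^ (i - s) * ((1 - q ^ Suc s) * F s) =
        (1 - q ^ Suc i) * (qbinom q i s * t ^ (i - s) * F s)" if "s \<le> i" for s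
      using qbinom_absorb[OF q that] by (metis (no_types, opaque_lifting) mult.assoc mult.commute)
    then show ?thesis
      unfolding Suc S_def sum.atMost_Suc_shift sum_distrib_left
      by (auto intro!: sum.cong simp del: power_Suc)
  qed simp
  have pascal: "(\<Sum>s\<le>j. qbinom q j s * t ^ (j - s) * (F (Suc s) + t * q ^ s * F s)) = S (Suc j)" for j
  proof -
    have "(\<Sum>s\<le>j. qbinom q j s * t ^ (j - s) * (F (Suc s) + t * q ^ s * F s)) =
        (\<Sum>s\<le>j. qbinom q j s * t ^ (j - s) * F (Suc s))
        + (\<Sum>s\<le>j. q ^ s * qbinom q j s * t ^ (Suc j - s) * F s)"
      unfolding sum.distrib[symmetric]
      by (intro sum.cong refl) (simp add: Suc_diff_le distrib_left mult_ac)
    also have "(\<Sum>s\<le>j. qbinom q j s * t ^ (j - s) * F (Suc s)) =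
        (\<Sum>s<j. qbinom q j s * t ^ (j - s) * F (Suc s)) + F (Suc j)"
      unfolding lessThan_Suc_atMost[symmetric] sum.lessThan_Suc by (simp add: qbinom_n_n[OF q])
    also have "(\<Sum>s\<le>j. q ^ s * qbinom q j s * t ^ (Suc j - s) * F s) =
        t ^ Suc j * F 0 + (\<Sum>s<j. q ^ Suc s * qbinom q j (Suc s) * t ^ (j - s) * F (Suc s))"
      unfolding lessThan_Suc_atMost[symmetric] sum.lessThan_Suc_shift
      by (simp add: qbinom_n_0[OF q] del: power_Suc)
    also have "(\<Sum>s<j. qbinom q j s * t ^ (j - s) * F (Suc s)) + F (Suc j) +
        (t ^ Suc j * F 0 + (\<Sum>s<j. q ^ Suc s * qbinom q j (Suc s) * t ^ (j - s) * F (Suc s)))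
      = t ^ Suc j * F 0 + (\<Sum>s<j. qbinom q (Suc j) (Suc s) * t ^ (j - s) * F (Suc s)) + F (Suc j)"
      by (simp add: qbinom_pascal[OF q] distrib_right sum.distrib del: power_Suc)
    also have "\<dots> = S (Suc j)"
      unfolding S_def sum.atMost_Suc_shift
      unfolding lessThan_Suc_atMost[symmetric] sum.lessThan_Suc
      by (simp add: qbinom_n_0[OF q] qbinom_n_n[OF q] del: power_Suc)
    finally show ?thesis .
  qed
  have S_Suc: "S (Suc j) = 2 * x * S j - (1 - q ^ j) * S (j - 1)" for j
  proof -
    have "2 * x * S j = (\<Sum>s\<le>j. qbinom q j s * t ^ (j - s) * (2 * x * F s))"
      unfolding S_def sum_distrib_left by (intro sum.cong refl) simp
    also have "\<dots> = (\<Sum>s\<le>j. qbinom q j s * t ^ (j - s) * (F (Suc s) + t * q ^ s * F s)) +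
        (\<Sum>s\<le>j. qbinom q j s * t ^ (j - s) * ((1 - q ^ s) * F (s - 1)))"
      unfolding F sum.distrib[symmetric] by (intro sum.cong refl) (simp only: distrib_left)
    finally show ?thesis
      unfolding pascal absorb by simp
  qed
  have "qherm q j x * F 0 = S j"
  proof (induction j rule: less_induct)
    case (less j)
    show ?case
    proof (cases j)
      case 0
      then show ?thesis by (simp add: S_def qbinom_n_0[OF q])
    next
      case (Suc i)
      have "qherm q i x * F 0 = S i" "qherm q (i - 1) x * F 0 = S (i - 1)"
        using less.IH by (simp_all add: Suc)
      then show ?thesis
        unfolding Suc S_Suc qherm_Suc by (simp add: left_diff_distrib mult.assoc)
    qed
  qed
  then show ?thesis
    by (simp add: S_def F_def phi_h_eq_qherm_gf atMost_atLeast0)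
qed

section \<open>Positivity of the generating function\<close>

text \<open>
  The difference \<open>\<phi>\<^sub>h(t) - \<phi>\<^sub>h(qt)\<close> has the factor \<open>1 - q\<^sup>m\<close> in its \<open>m\<close>th term. Shifting the
  index turns it into \<open>t F\<^sub>1(t)\<close>, and \<open>F\<^sub>1 = (2x - t) F\<^sub>0\<close>.
\<close>

lemma phi_h_functional_equation:
  assumes q: "\<bar>q\<bar> < 1" and t: "\<bar>t\<bar> < 1" and x: "\<bar>x\<bar> \<le> 1"
  shows "(1 - 2 * t * x + t\<^sup>2) * phi_h q t x = phi_h q (q * t) x"
proof -
  have qt: "\<bar>q * t\<bar> < 1"
    using mult_strict_mono'[OF q t] by (simp add: abs_mult)
  have "(\<lambda>m. t ^ m / qpoch q m * qherm q (0 + m) x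
        - (q * t) ^ m / qpoch q m * qherm q (0 + m) x)
      sums (phi_h q t x - phi_h q (q * t) x)"
    unfolding phi_h_eq_qherm_gf qherm_gf_def
    by (intro sums_diff summable_sums summable_qherm_gf q t x qt)
  moreover have "t ^ m / qpoch q m * qherm q (0 + m) x - (q * t) ^ m / qpoch q m * qherm q (0 + m) x
      = (1 - q ^ m) * (t ^ m / qpoch q m * qherm q (Suc 0 + m - 1) x)" for m
    by (simp add: power_mult_distrib left_diff_distrib right_diff_distrib diff_divide_distrib mult_ac)
  ultimately have "phi_h q t x - phi_h q (q * t) x = t * qherm_gf q (Suc 0) t x"
    using sums_qherm_gf_index_shift[OF assms, of "Suc 0"] by (simp add: sums_iff)
  then show ?thesis
    unfolding qherm_gf_Suc[OF assms]
    by (simp add: phi_h_eq_qherm_gf algebra_simps power2_eq_square)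
qed

lemma isCont_phi_h_0:
  assumes q: "\<bar>q\<bar> < 1" and x: "\<bar>x\<bar> \<le> 1"
  shows "isCont (\<lambda>t. phi_h q t x) 0"
proof -
  have "summable (\<lambda>m. qherm q m x / qpoch q m * (1 / 2) ^ m)"
    using summable_qherm_gf[OF q _ x, of "1 / 2" 0] by (simp add: field_simps)
  then have "isCont (\<lambda>t. \<Sum>m. qherm q m x / qpoch q m * t ^ m) 0"
    by (rule isCont_powser) simp
  then show ?thesis
    by (simp add: phi_h_def mult.commute)
qed

lemma phi_h_pos:
  assumes q: "\<bar>q\<bar> < 1" and t: "\<bar>t\<bar> < 1" and x: "\<bar>x\<bar> \<le> 1"
  shows "phi_h q t x > 0"
proof -
  have step: "phi_h q t x > 0" if "phi_h q (q * t) x > 0" "\<bar>t\<bar> < 1" for t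
  proof -
    have "\<bar>t * x\<bar> \<le> \<bar>t\<bar>"
      using x by (simp add: abs_mult mult_left_le)
    then have "t * x \<le> \<bar>t\<bar>"
      by linarith
    moreover have "0 < (1 - \<bar>t\<bar>)\<^sup>2"
      using that(2) by simp
    moreover have "(1 - \<bar>t\<bar>)\<^sup>2 = 1 - 2 * \<bar>t\<bar> + t\<^sup>2"
      by (simp add: power2_diff)
    ultimately have "0 < 1 - 2 * t * x + t\<^sup>2"
      by linarith
    moreover have "0 < (1 - 2 * t * x + t\<^sup>2) * phi_h q t x"
      using phi_h_functional_equation[OF q that(2) x] that(1) by simp
    ultimately show ?thesis
      by (simp add: zero_less_mult_iff)
  qed
  have "phi_h q 0 x = 1"
    using powser_zero[of "\<lambda>m. qherm q m x / qpoch q m"] by (simp add: phi_h_def mult.commute)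
  then have "(\<lambda>N. phi_h q (q ^ N * t) x) \<longlonglongrightarrow> 1"
    using isCont_tendsto_compose[OF isCont_phi_h_0[OF q x], of "\<lambda>N. q ^ N * t"]
      tendsto_mult_left_zero[OF LIMSEQ_power_zero[of q], of t] q by simp
  then have "\<forall>\<^sub>F N in sequentially. phi_h q (q ^ N * t) x > 0"
    by (rule order_tendstoD) simp
  then obtain N where "phi_h q (q ^ N * t) x > 0"
    unfolding eventually_sequentially by blast
  then show ?thesis
  proof (induction N)
    case (Suc N)
    have "\<bar>q ^ N * t\<bar> \<le> 1 * \<bar>t\<bar>"
      unfolding abs_mult power_abs using q by (intro mult_right_mono power_le_one) auto
    with Suc t show ?case
      using step[of "q ^ N * t"] by (simp add: mult.assoc)
  qed simp
qed

section \<open>The densities and their normalizing constants\<close>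

lemma l_fun_pos:
  assumes "\<bar>b\<bar> < 1" "\<bar>x\<bar> \<le> 1"
  shows "l_fun x b > 0"
proof -
  have "x\<^sup>2 \<le> 1"
    using assms(2) by (simp add: abs_square_le_1)
  have "l_fun x b = (1 - b)\<^sup>2 * x\<^sup>2 + (1 + b)\<^sup>2 * (1 - x\<^sup>2)"
    by (simp add: l_fun_def power2_eq_square algebra_simps)
  moreover have "(1 - b)\<^sup>2 > 0" "(1 + b)\<^sup>2 > 0"
    using assms(1) by (auto simp: zero_less_power2)
  ultimately show ?thesis
    using \<open>x\<^sup>2 \<le> 1\<close>
    by (cases "x = 0") (auto intro!: add_pos_nonneg mult_pos_pos mult_nonneg_nonneg)
qed

lemma l_fun_minus_1_bound:
  assumes "\<bar>b\<bar> \<le> 1" "\<bar>x\<bar> \<le> 1"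
  shows "\<bar>l_fun x b - 1\<bar> \<le> 7 * \<bar>b\<bar>"
proof -
  have "x\<^sup>2 \<le> 1"
    using assms(2) by (simp add: abs_square_le_1)
  have "\<bar>2 + b - 4 * x\<^sup>2\<bar> \<le> 7"
    using assms(1) \<open>x\<^sup>2 \<le> 1\<close> zero_le_power2[of x] by linarith
  then have "\<bar>2 + b - 4 * x\<^sup>2\<bar> * \<bar>b\<bar> \<le> 7 * \<bar>b\<bar>"
    by (rule mult_right_mono) simp
  moreover have "l_fun x b - 1 = (2 + b - 4 * x\<^sup>2) * b"
    by (simp add: l_fun_def power2_eq_square algebra_simps)
  ultimately show ?thesis
    by (simp add: abs_mult)
qed

lemma l_fun_power_minus_1_bound:
  assumes q: "\<bar>q\<bar> < 1" and x: "\<bar>x\<bar> \<le> 1"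
  shows "\<bar>l_fun x (q ^ Suc k) - 1\<bar> \<le> 7 * \<bar>q\<bar> ^ Suc k"
  using l_fun_minus_1_bound[OF _ x, of "q ^ Suc k"] q
  by (simp add: power_abs power_le_one abs_mult mult_le_one)

lemma summable_l_fun_bound:
  fixes q :: real
  assumes "\<bar>q\<bar> < 1"
  shows "summable (\<lambda>k. 7 * \<bar>q\<bar> ^ Suc k)"
  using assms by (intro summable_mult) (simp add: summable_mult summable_geometric)

lemma convergent_prod_l_fun:
  assumes q: "\<bar>q\<bar> < 1" and x: "\<bar>x\<bar> \<le> 1"
  shows "convergent_prod (\<lambda>k. l_fun x (q ^ Suc k))"
proof -
  have "summable (\<lambda>k. norm (l_fun x (q ^ Suc k) - 1))"
    using l_fun_power_minus_1_bound[OF assms]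
    by (intro summable_comparison_test'[OF summable_l_fun_bound[OF q], of 0])
      (simp add: real_norm_def del: power_Suc)
  then show ?thesis
    by (intro abs_convergent_prod_imp_convergent_prod summable_imp_abs_convergent_prod)
qed

lemma f_h_pos:
  assumes q: "\<bar>q\<bar> < 1" and x: "\<bar>x\<bar> < 1"
  shows "f_h q x > 0"
proof -
  have "(\<Prod>k. l_fun x (q ^ Suc k)) > 0"
    using x by (intro less_0_prodinf convergent_prod_l_fun q l_fun_pos abs_power_Suc_less_1) auto
  moreover have "x\<^sup>2 < 1"
    using x by (simp add: abs_square_less_1)
  ultimately show ?thesis
    unfolding f_h_def using qpoch_inf_pos[OF q]
    by (intro mult_pos_pos divide_pos_pos) auto
qed

lemma continuous_on_f_h:
  assumes q: "\<bar>q\<bar> < 1"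
  shows "continuous_on {-1..1} (f_h q)"
proof -
  have cont: "continuous_on {-1..1} (\<lambda>x. l_fun x (q ^ Suc k))" for k
    unfolding l_fun_def by (intro continuous_intros)
  have "uniformly_convergent_on {-1..1} (\<lambda>N x. \<Sum>k<N. norm (l_fun x (q ^ Suc k) - 1))"
  proof (rule Weierstrass_m_test'[OF _ summable_l_fun_bound[OF q]])
    fix k and x :: real
    assume "x \<in> {-1..1}"
    then show "norm (norm (l_fun x (q ^ Suc k) - 1)) \<le> 7 * \<bar>q\<bar> ^ Suc k"
      unfolding real_norm_def abs_idempotent by (intro l_fun_power_minus_1_bound q) auto
  qed
  then have "uniformly_convergent_on {-1..1} (\<lambda>N x. \<Prod>k<N. l_fun x (q ^ Suc k))"
    by (intro uniformly_convergent_on_prod' cont) auto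
  then obtain P where P: "uniform_limit {-1..1} (\<lambda>N x. \<Prod>k<N. l_fun x (q ^ Suc k)) P sequentially"
    unfolding uniformly_convergent_on_def by blast
  have P_eq: "P x = (\<Prod>k. l_fun x (q ^ Suc k))" if "x \<in> {-1..1}" for x
  proof -
    have "(\<lambda>N. \<Prod>k\<le>N. l_fun x (q ^ Suc k)) \<longlonglongrightarrow> (\<Prod>k. l_fun x (q ^ Suc k))"
      using that by (intro convergent_prod_LIMSEQ convergent_prod_l_fun q) auto
    moreover have "(\<lambda>N. \<Prod>k<Suc N. l_fun x (q ^ Suc k)) \<longlonglongrightarrow> P x"
      using tendsto_uniform_limitI[OF P that] by (rule LIMSEQ_Suc)
    ultimately show ?thesis
      by (simp only: lessThan_Suc_atMost LIMSEQ_unique)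
  qed
  have "continuous_on {-1..1} P"
    by (rule uniform_limit_theorem[OF _ P])
      (auto intro!: always_eventually continuous_on_prod cont simp del: power_Suc)
  then have "continuous_on {-1..1} (\<lambda>x. \<Prod>k. l_fun x (q ^ Suc k))"
    by (simp only: P_eq cong: continuous_on_cong)
  then show ?thesis
    unfolding f_h_def by (intro continuous_intros) auto
qed

lemma continuous_on_g_fun:
  assumes q: "\<bar>q\<bar> < 1" and a: "\<And>k. 1 \<le> k \<Longrightarrow> k \<le> n \<Longrightarrow> \<bar>a k\<bar> < 1"
  shows "continuous_on {-1..1} (g_fun q n a)"
  unfolding g_fun_def phi_h_eq_qherm_gf
  by (intro continuous_on_mult continuous_on_prod continuous_on_f_h continuous_on_qherm_gf q)
    (auto intro: a)

lemma A_coeff_pos: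
  assumes q: "\<bar>q\<bar> < 1" and a: "\<And>k. 1 \<le> k \<Longrightarrow> k \<le> n \<Longrightarrow> \<bar>a k\<bar> < 1"
  shows "A_coeff q n a > 0"
proof -
  have pos: "0 < g_fun q n a x" if "x \<in> {-1<..<1}" for x
    unfolding g_fun_def using that
    by (intro mult_pos_pos f_h_pos prod_pos phi_h_pos q) (auto intro: a)
  have cont: "continuous_on {-1..1} (g_fun q n a)"
    using continuous_on_g_fun[of q n a] q a by simp
  have "integral {-1..1} (\<lambda>_::real. 0) < integral {-1..1} (g_fun q n a)"
    by (rule integral_less_real[OF continuous_on_const cont _ pos]) auto
  then show ?thesis
    by (simp add: A_coeff_def)
qed

section \<open>Termwise integration\<close>

lemma sums_integral_qherm_gf:
  assumes q: "\<bar>q\<bar> < 1" and t: "\<bar>t\<bar> < 1" and w: "continuous_on {-1..1} w"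
  shows "(\<lambda>m. t ^ m / qpoch q m * integral {-1..1} (\<lambda>x. qherm q (s + m) x * w x))
    sums integral {-1..1} (\<lambda>x. qherm_gf q s t x * w x)"
proof -
  let ?p = "\<lambda>N x. \<Sum>m<N. t ^ m / qpoch q m * qherm q (s + m) x"
  have "uniform_limit {-1..1} (\<lambda>N x. ?p N x * w x) (\<lambda>x. qherm_gf q s t x * w x) sequentially"
    by (intro uniform_lim_mult uniform_limit_qherm_gf q t uniform_limit_const
        compact_imp_bounded compact_continuous_image continuous_on_qherm_gf w compact_Icc)
  moreover have "continuous_on {-1..1} (\<lambda>x. ?p N x * w x)" for N
    by (intro continuous_intros continuous_on_qherm w)
  ultimately obtain I J where I: "\<And>N. ((\<lambda>x. ?p N x * w x) has_integral I N) {-1..1}"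
    and J: "((\<lambda>x. qherm_gf q s t x * w x) has_integral J) {-1..1}" and IJ: "I \<longlonglongrightarrow> J"
    using uniform_limit_integral[OF _ _ sequentially_bot] by blast
  have "I N = (\<Sum>m<N. t ^ m / qpoch q m * integral {-1..1} (\<lambda>x. qherm q (s + m) x * w x))" for N
  proof -
    have "(\<lambda>x. qherm q k x * w x) integrable_on {-1..1}" for k
      by (intro integrable_continuous_real continuous_on_mult continuous_on_qherm w)
    then have "((\<lambda>x. \<Sum>m<N. t ^ m / qpoch q m * (qherm q (s + m) x * w x)) has_integral
        (\<Sum>m<N. t ^ m / qpoch q m * integral {-1..1} (\<lambda>x. qherm q (s + m) x * w x))) {-1..1}"
      by (intro has_integral_sum has_integral_mult_right integrable_integral) auto
    with I[of N] show ?thesis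
      by (simp add: sum_distrib_right mult.assoc has_integral_unique)
  qed
  then have "I = (\<lambda>N. \<Sum>m<N. t ^ m / qpoch q m * integral {-1..1} (\<lambda>x. qherm q (s + m) x * w x))"
    by (rule ext)
  with IJ show ?thesis
    unfolding sums_def integral_unique[OF J] by simp
qed

section \<open>The recursion for the constants and the Fourier coefficients\<close>

theorem proposition3:
  fixes q :: real and n :: nat and a :: "nat \<Rightarrow> real" and H :: "nat \<Rightarrow> real"
  assumes q: "-1 < q" "q < 1"
    and n: "n \<ge> 1"
    and a: "\<And>k. 1 \<le> k \<Longrightarrow> k \<le> n \<Longrightarrow> \<bar>a k\<bar> < 1"
    and H: "\<And>s. (\<Sum>m. a n ^ m / qpoch q m * T_coeff q (n - 1) a (s + m)) =
                 H s * (\<Sum>m. a n ^ m / qpoch q m * T_coeff q (n - 1) a m)"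
  shows "(\<forall>s. summable (\<lambda>m. a n ^ m / qpoch q m * T_coeff q (n - 1) a (s + m)))
    \<and> (\<Sum>m. a n ^ m / qpoch q m * T_coeff q (n - 1) a m) \<noteq> 0
    \<and> A_coeff q n a =
        A_coeff q (n - 1) a * (\<Sum>m. a n ^ m / qpoch q m * T_coeff q (n - 1) a m)
    \<and> (\<forall>j. T_coeff q n a j = (\<Sum>s=0..j. qbinom q j s * H s * a n ^ (j - s)))"
proof -
  have q1: "\<bar>q\<bar> < 1"
    using q by auto
  define t where "t = a n"
  define w where "w = g_fun q (n - 1) a"
  define F where "F = (\<lambda>s. integral {-1..1} (\<lambda>x. qherm_gf q s t x * w x))"
  define S where "S = (\<lambda>s. \<Sum>m. t ^ m / qpoch q m * T_coeff q (n - 1) a (s + m))"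
  have t: "\<bar>t\<bar> < 1"
    using a n by (simp add: t_def)
  have w: "continuous_on {-1..1} w"
    unfolding w_def by (intro continuous_on_g_fun q1 a) auto
  have A_pred: "A_coeff q (n - 1) a > 0" and A_n: "A_coeff q n a > 0"
    using a by (auto intro!: A_coeff_pos q1)
  have g_n: "g_fun q n a x = phi_h q t x * w x" for x
    using n by (cases n) (simp_all add: g_fun_def w_def t_def)

  have sums: "(\<lambda>m. t ^ m / qpoch q m * T_coeff q (n - 1) a (s + m)) sums
      (F s / A_coeff q (n - 1) a)" for s
    using sums_divide[OF sums_integral_qherm_gf[OF q1 t w, of s], of "A_coeff q (n - 1) a"]
    by (simp add: T_coeff_def w_def F_def)
  have S_eq: "S s = F s / A_coeff q (n - 1) a" for s
    unfolding S_def using sums[of s] by (simp add: sums_iff)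
  have F_0: "F 0 = A_coeff q n a"
    unfolding F_def A_coeff_def g_n[abs_def] phi_h_eq_qherm_gf ..
  have S_0: "S 0 \<noteq> 0" "A_coeff q n a = A_coeff q (n - 1) a * S 0"
    unfolding S_eq F_0 using A_n A_pred by auto
  have H_eq: "H s = F s / A_coeff q n a" for s
  proof -
    have "S s = H s * S 0"
      using H[of s] by (simp add: S_def t_def)
    then show ?thesis
      unfolding S_eq F_0 using A_n A_pred by (simp add: field_simps)
  qed

  have T: "T_coeff q n a j = (\<Sum>s=0..j. qbinom q j s * H s * t ^ (j - s))" for j
  proof -
    have "(\<lambda>x. qherm_gf q s t x * w x) integrable_on {-1..1}" for s
      by (intro integrable_continuous_real continuous_on_mult continuous_on_qherm_gf q1 t w)
    then have "((\<lambda>x. \<Sum>s=0..j. qbinom q j s * t ^ (j - s) * (qherm_gf q s t x * w x)) has_integral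
        (\<Sum>s=0..j. qbinom q j s * t ^ (j - s) * F s)) {-1..1}"
      unfolding F_def by (intro has_integral_sum has_integral_mult_right integrable_integral) auto
    moreover have "qherm q j x * g_fun q n a x =
        (\<Sum>s=0..j. qbinom q j s * t ^ (j - s) * (qherm_gf q s t x * w x))" if "x \<in> {-1..1}" for x
    proof -
      have "\<bar>x\<bar> \<le> 1"
        using that by auto
      from qherm_mult_phi_h[OF q1 t this, of j] show ?thesis
        unfolding g_n mult.assoc[symmetric] by (simp only: sum_distrib_right)
    qed
    ultimately have "((\<lambda>x. qherm q j x * g_fun q n a x) has_integral
        (\<Sum>s=0..j. qbinom q j s * t ^ (j - s) * F s)) {-1..1}"
      by (subst has_integral_cong)
    then have "integral {-1..1} (\<lambda>x. qherm q j x * g_fun q n a x) =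
        (\<Sum>s=0..j. qbinom q j s * t ^ (j - s) * F s)"
      by (rule integral_unique)
    then show ?thesis
      by (simp add: T_coeff_def H_eq sum_divide_distrib mult_ac)
  qed

  have "summable (\<lambda>m. t ^ m / qpoch q m * T_coeff q (n - 1) a (s + m))" for s
    using sums[of s] by (simp only: sums_iff)
  then show ?thesis
    using S_0 T unfolding S_def t_def add_0 by blast
qed

end
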